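(* Let $n\ge2$ and let $f$ be a Möbius transformation of $\overline{\mathbb{R}}^n$ with $f(\mathbb{H}^n)=\mathbb{B}^n$. Then for all $x,y\in\mathbb{H}^n$, $$\tfrac12\tilde\tau_{\mathbb{H}^n}(x,y)\le\tilde\tau_{\mathbb{B}^n}(f(x),f(y))\le2\tilde\tau_{\mathbb{H}^n}(x,y),$$ and the constants $\tfrac12$ and $2$ are best possible, i.e. $$\inf_{x\ne y}\frac{\tilde\tau_{\mathbb{B}^n}(f(x),f(y))}{\tilde\tau_{\mathbb{H}^n}(x,y)}=\tfrac12,\qquad \sup_{x\ne y}\frac{\tilde\tau_{\mathbb{B}^n}(f(x),f(y))}{\tilde\tau_{\mathbb{H}^n}(x,y)}=2.$$
   Context: $\mathbb{B}^n=\{z\in\mathbb{R}^n:|z|<1\}$, $\mathbb{H}^n=\{x\in\mathbb{R}^n:x_n>0\}$ (boundary taken in $\mathbb{R}^n$), $\overline{\mathbb{R}}^n=\mathbb{R}^n\cup\{\infty\}$. For a proper subdomain $D\subsetneq\mathbb{R}^n$ and $x,y\in D$, $\tilde\tau_D(x,y)=\log\big(1+\sup_{p\in\partial D}\frac{|x-y|}{\sqrt{|x-p||y-p|}}\big)$ (the scale invariant Cassinian metric). *)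

theory Defs
  imports "HOL-Analysis.Analysis"
begin

text \<open>The extended space: None plays the role of the point at infinity.\<close>

definition sphere_inversion :: "'a::real_inner \<Rightarrow> real \<Rightarrow> 'a option \<Rightarrow> 'a option" where
  "sphere_inversion a r z = (case z of
      None \<Rightarrow> Some a
    | Some x \<Rightarrow> (if x = a then None
                 else Some (a + (r\<^sup>2 / (norm (x - a))\<^sup>2) *\<^sub>R (x - a))))"

definition hyperplane_reflection :: "'a::real_inner \<Rightarrow> real \<Rightarrow> 'a option \<Rightarrow> 'a option" where
  "hyperplane_reflection u t z = (case z of
      None \<Rightarrow> None
    | Some x \<Rightarrow> Some (x - (2 * (inner x u - t) / (norm u)\<^sup>2) *\<^sub>R u))"

definition reflection_map :: "('a::real_inner option \<Rightarrow> 'a option) \<Rightarrow> bool" where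
  "reflection_map g \<longleftrightarrow>
     (\<exists>a r. r > 0 \<and> g = sphere_inversion a r) \<or>
     (\<exists>u t. u \<noteq> 0 \<and> g = hyperplane_reflection u t)"

inductive mobius :: "('a::real_inner option \<Rightarrow> 'a option) \<Rightarrow> bool" where
  base: "reflection_map g \<Longrightarrow> mobius g"
| comp: "mobius f \<Longrightarrow> reflection_map g \<Longrightarrow> mobius (g \<circ> f)"

definition unit_ball :: "(real^'n::finite) set" where
  "unit_ball = {z. norm z < 1}"

definition upper_half :: "(real^'n::{finite,linorder}) set" where
  "upper_half = {x. x $ (Max UNIV) > 0}"

definition cassinian_tilde :: "'a::real_normed_vector set \<Rightarrow> 'a \<Rightarrow> 'a \<Rightarrow> real" where
  "cassinian_tilde D x y =
     ln (1 + (SUP p\<in>frontier D. dist x y / sqrt (dist x p * dist y p)))"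

end

theory Submission
  imports Defs "HOL-Real_Asymp.Real_Asymp"
begin

text \<open>
  With the convention \<open>hdist z \<infinity> = 1\<close>, a Moebius map \<open>f\<close> satisfies
  \<open>hdist (f u) (f v) = l u * l v * hdist u v\<close> for a positive weight \<open>l\<close>, so the ratio
  \<open>R u v p q = |u-v||p-q| / sqrt (|u-p||v-p||u-q||v-q|)\<close> is invariant. For convex open \<open>U\<close> the
  supremum \<open>S\<close> of \<open>R x y p \<infinity>\<close> over \<open>\<partial>U\<close> equals the one over the complement of \<open>U\<close>, and
  a four-point inequality gives \<open>R x y p q \<le> S\<^sup>2 + 2S = (1+S)\<^sup>2 - 1\<close> for all \<open>p\<close>, \<open>q\<close> outside \<open>U\<close>.
  Since \<open>f\<close> is a bijection, it exchanges complements, and both inequalities follow by applying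
  this bound to \<open>f\<close> and to its inverse. The constant 2 is approached by \<open>x = e\<^sub>n\<close>,
  \<open>y = e\<^sub>n + T e\<^sub>i\<close> (\<open>S\<close> grows like \<open>sqrt T\<close> in the half-space and like \<open>T\<close> in the ball), the constant
  1/2 by \<open>x = e\<^sub>n / s\<close>, \<open>y = s e\<^sub>n\<close> (\<open>s\<close> versus \<open>sqrt s\<close>).
\<close>

section \<open>Extended distance, cross ratio and Cassinian supremum\<close>

text \<open>In Euclidean space this is the chordal metric up to a positive factor for each argument,
  and not itself a metric. Such factors cancel in a cross ratio, so the value \<open>1\<close> at
  infinity yields the usual limits there.\<close>

definition hdist :: "'a::real_normed_vector option \<Rightarrow> 'a option \<Rightarrow> real" where
  "hdist u v = (case u of
      None \<Rightarrow> (case v of None \<Rightarrow> 0 | Some y \<Rightarrow> 1)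
    | Some x \<Rightarrow> (case v of None \<Rightarrow> 1 | Some y \<Rightarrow> dist x y))"

text \<open>The geometric mean of the absolute cross ratios |u-v||p-q| / (|u-p||v-q|) and |u-v||p-q|
  / (|u-q||v-p|), hence symmetric in \<open>p\<close> and \<open>q\<close>. For
  \<open>q = None\<close> and finite \<open>u\<close>, \<open>v\<close>, \<open>p\<close> it is a
  term of the Cassinian supremum.\<close>

definition cross_ratio :: "'a::real_normed_vector option \<Rightarrow> 'a option \<Rightarrow> 'a option \<Rightarrow> 'a option \<Rightarrow> real" where
  "cross_ratio u v p q =
     hdist u v * hdist p q / sqrt (hdist u p * hdist v p * hdist u q * hdist v q)"

definition cassinian_sup :: "'a::real_normed_vector set \<Rightarrow> 'a \<Rightarrow> 'a \<Rightarrow> real" where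
  "cassinian_sup U x y = (SUP p\<in>frontier U. dist x y / sqrt (dist x p * dist y p))"

lemma hdist_simps [simp]:
  "hdist None None = 0" "hdist None (Some y) = 1" "hdist (Some x) None = 1"
  "hdist (Some x) (Some y) = dist x y"
  by (simp_all add: hdist_def)

lemma hdist_eq_0_iff: "hdist u v = 0 \<longleftrightarrow> u = v"
  by (cases u; cases v) auto

lemma cassinian_tilde_eq: "cassinian_tilde U x y = ln (1 + cassinian_sup U x y)"
  by (simp add: cassinian_tilde_def cassinian_sup_def)

section \<open>Moebius maps and invariance of the cross ratio\<close>

text \<open>The distance formula for inversions with the centre moved to the origin, to be used with
  \<open>c = r^2\<close>.\<close>

lemma norm_inversion_diff:
  fixes u v :: "'a::real_inner"
  assumes "u \<noteq> 0" "v \<noteq> 0"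
  shows "norm ((c / (norm u)\<^sup>2) *\<^sub>R u - (c / (norm v)\<^sup>2) *\<^sub>R v) = \<bar>c\<bar> * norm (u - v) / (norm u * norm v)"
proof -
  have "(norm ((c / (norm u)\<^sup>2) *\<^sub>R u - (c / (norm v)\<^sup>2) *\<^sub>R v))\<^sup>2
      = (\<bar>c\<bar> * norm (u - v) / (norm u * norm v))\<^sup>2"
    unfolding power_divide power_mult_distrib dot_square_norm[symmetric]
    using assms
    by (simp add: inner_diff_left inner_diff_right inner_commute field_simps power2_eq_square)
  then show ?thesis
    by (subst (asm) power2_eq_iff_nonneg) auto
qed

lemma sphere_inversion_hdist:
  fixes a :: "'a::real_inner"
  assumes "r > 0"
  shows "\<exists>l. (\<forall>u. l u > 0) \<and>
    (\<forall>u v. hdist (sphere_inversion a r u) (sphere_inversion a r v) = l u * l v * hdist u v)"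
proof -
  \<comment> \<open>The generic weight comes from the distance formula. The other two are forced:
    \<open>None\<close> goes to \<open>a\<close>, at distance r^2 / |x-a| from the image of
    \<open>x\<close>, which requires \<open>r\<close>; and \<open>a\<close> goes to
    \<open>None\<close>, at \<open>hdist\<close> 1 from that image, which requires
    \<open>1 / r\<close>.\<close>
  define l where "l u = (case u of None \<Rightarrow> r | Some x \<Rightarrow> if x = a then 1 / r else r / norm (x - a))"
    for u :: "'a option"
  have 1: "l u > 0" for u
    using assms by (auto simp: l_def split: option.split)
  have 2: "hdist (sphere_inversion a r u) (sphere_inversion a r v) = l u * l v * hdist u v" for u v
  proof (cases "\<exists>x y. u = Some x \<and> v = Some y \<and> x \<noteq> a \<and> y \<noteq> a")
    case True
    then obtain x y where "u = Some x" "v = Some y" "x \<noteq> a" "y \<noteq> a" by blast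
    then show ?thesis
      using norm_inversion_diff[of "x - a" "y - a" "r\<^sup>2"] assms
      by (simp add: l_def sphere_inversion_def dist_norm power2_eq_square)
  next
    case False
    then show ?thesis
      using assms
      by (cases u; cases v)
        (auto simp: l_def sphere_inversion_def dist_norm power2_eq_square norm_minus_commute)
  qed
  show ?thesis using 1 2 by blast
qed

lemma hyperplane_reflection_hdist:
  fixes n :: "'a::real_inner"
  assumes "n \<noteq> 0"
  shows "hdist (hyperplane_reflection n t u) (hyperplane_reflection n t v) = hdist u v"
proof -
  have "norm (w - (2 * inner w n / (norm n)\<^sup>2) *\<^sub>R n) = norm w" for w
  proof -
    have "(norm (w - (2 * inner w n / (norm n)\<^sup>2) *\<^sub>R n))\<^sup>2 = (norm w)\<^sup>2"
      unfolding dot_square_norm[symmetric]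
      using assms by (simp add: inner_diff_left inner_diff_right inner_commute field_simps power2_eq_square)
    then show ?thesis by simp
  qed
  moreover have "x - (2 * (inner x n - t) / (norm n)\<^sup>2) *\<^sub>R n - (y - (2 * (inner y n - t) / (norm n)\<^sup>2) *\<^sub>R n)
     = (x - y) - (2 * inner (x - y) n / (norm n)\<^sup>2) *\<^sub>R n" for x y
    by (simp add: inner_diff_left algebra_simps diff_divide_distrib)
  ultimately have "dist (x - (2 * (inner x n - t) / (norm n)\<^sup>2) *\<^sub>R n) (y - (2 * (inner y n - t) / (norm n)\<^sup>2) *\<^sub>R n)
     = dist x y" for x y
    by (simp only: dist_norm)
  then show ?thesis
    unfolding hyperplane_reflection_def hdist_def by (auto split: option.split)
qed

lemma reflection_map_surj:
  assumes "reflection_map g"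
  shows "surj g"
proof -
  have "g (g u) = u" for u
    using assms unfolding reflection_map_def
  proof (elim disjE exE conjE)
    fix a r assume "(0::real) < r" "g = sphere_inversion a r"
    then show ?thesis
      by (cases u) (auto simp: sphere_inversion_def power_divide power_mult_distrib power2_eq_square)
  next
    fix n t assume "n \<noteq> 0" "g = hyperplane_reflection n t"
    then show ?thesis
      by (cases u)
        (auto simp: hyperplane_reflection_def inner_diff_left power2_norm_eq_inner field_simps
           simp flip: scaleR_add_left scaleR_diff_left)
  qed
  then show ?thesis by (metis surjI)
qed

lemma reflection_map_hdist:
  assumes "reflection_map g"
  shows "\<exists>l. (\<forall>u. l u > 0) \<and> (\<forall>u v. hdist (g u) (g v) = l u * l v * hdist u v)"
  using assms unfolding reflection_map_def
proof (elim disjE exE conjE)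
  fix n t assume "n \<noteq> 0" "g = hyperplane_reflection n t"
  then show ?thesis
    by (intro exI[of _ "\<lambda>_. 1"]) (simp add: hyperplane_reflection_hdist)
qed (use sphere_inversion_hdist in blast)

text \<open>The weight plays the role of the square root of the conformal factor; as in the chain
  rule, weights multiply under composition.\<close>

lemma mobius_hdist:
  assumes "mobius f"
  shows "\<exists>l. (\<forall>u. l u > 0) \<and> (\<forall>u v. hdist (f u) (f v) = l u * l v * hdist u v)"
  using assms
proof induction
  case (comp f g)
  obtain l where l: "\<forall>u. l u > 0" "\<forall>u v. hdist (f u) (f v) = l u * l v * hdist u v"
    using comp.IH by blast
  obtain m where m: "\<forall>u. m u > 0" "\<forall>u v. hdist (g u) (g v) = m u * m v * hdist u v"
    using reflection_map_hdist[OF comp.hyps(2)] by blast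
  show ?case
    using l m by (intro exI[of _ "\<lambda>u. m (f u) * l u"]) simp
qed (rule reflection_map_hdist)

text \<open>Injectivity can be read off from the positive weights, since \<open>hdist\<close>
  vanishes only on the diagonal; surjectivity is inherited from the reflections.\<close>

lemma mobius_bij:
  assumes "mobius f"
  shows "bij f"
proof (rule bijI)
  obtain l where l: "\<forall>u. l u > 0" "\<forall>u v. hdist (f u) (f v) = l u * l v * hdist u v"
    using mobius_hdist[OF assms] by blast
  show "inj f"
  proof (rule injI)
    fix u v assume "f u = f v"
    then have "l u * l v * hdist u v = 0" using l(2) hdist_eq_0_iff by metis
    then show "u = v" using l(1)[rule_format, of u] l(1)[rule_format, of v] by (simp add: hdist_eq_0_iff)
  qed
  show "surj f" using assms
    by induction (simp_all only: reflection_map_surj comp_surj)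
qed

lemma mobius_cross_ratio:
  assumes "mobius f"
  shows "cross_ratio (f u) (f v) (f p) (f q) = cross_ratio u v p q"
proof -
  obtain l where l: "\<forall>u. l u > 0" "\<forall>u v. hdist (f u) (f v) = l u * l v * hdist u v"
    using mobius_hdist[OF assms] by blast
  \<comment> \<open>Each of the four points occurs once in the numerator and twice under the root,
    so the same factor comes out of both.\<close>
  let ?L = "l u * l v * l p * l q"
  have L: "?L > 0" using l(1) by simp
  have "sqrt (hdist (f u) (f p) * hdist (f v) (f p) * hdist (f u) (f q) * hdist (f v) (f q))
      = sqrt (?L\<^sup>2 * (hdist u p * hdist v p * hdist u q * hdist v q))"
    by (rule arg_cong[of _ _ sqrt]) (simp add: l(2) power2_eq_square)
  also have "\<dots> = ?L * sqrt (hdist u p * hdist v p * hdist u q * hdist v q)"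
    unfolding real_sqrt_mult[of "?L\<^sup>2"] real_sqrt_abs using L by simp
  finally have den: "sqrt (hdist (f u) (f p) * hdist (f v) (f p) * hdist (f u) (f q) * hdist (f v) (f q))
      = ?L * sqrt (hdist u p * hdist v p * hdist u q * hdist v q)" .
  have num: "hdist (f u) (f v) * hdist (f p) (f q) = ?L * (hdist u v * hdist p q)"
    by (simp add: l(2))
  show ?thesis
    unfolding cross_ratio_def den num
    using L by (subst mult_divide_mult_cancel_left) auto
qed

section \<open>The four-point inequality\<close>

lemma cross_ratio_bound:
  fixes x y p q :: "'a::real_normed_vector"
  assumes pos: "x \<noteq> p" "y \<noteq> p" "x \<noteq> q" "y \<noteq> q"
    and p: "dist x y / sqrt (dist x p * dist y p) \<le> S"
    and q: "dist x y / sqrt (dist x q * dist y q) \<le> S"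
  shows "cross_ratio (Some x) (Some y) (Some p) (Some q) \<le> S\<^sup>2 + 2 * S"
proof -
  let ?d = "dist x y"
  have S: "S \<ge> 0" using p by (meson divide_nonneg_nonneg order_trans real_sqrt_ge_zero mult_nonneg_nonneg zero_le_dist)
  \<comment> \<open>First a bound for a single point: the hypothesis bounds the product of the two
    quotients by S^2, and the triangle inequality bounds their difference by their product. Product
    and difference together control the sum.\<close>
  have *: "?d / dist x z + ?d / dist y z \<le> S\<^sup>2 + 2 * S"
    if "x \<noteq> z" "y \<noteq> z" and z: "?d / sqrt (dist x z * dist y z) \<le> S" for z
  proof -
    let ?A = "?d / dist x z" and ?C = "?d / dist y z"
    have "(?d / sqrt (dist x z * dist y z))\<^sup>2 \<le> S\<^sup>2"
      using z by (intro power_mono) auto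
    then have AC: "?A * ?C \<le> S\<^sup>2"
      by (simp add: power_divide) (simp add: power2_eq_square)
    have "\<bar>dist y z - dist x z\<bar> \<le> ?d"
      using abs_dist_diff_le[of y z x] by (simp add: dist_commute)
    then have "?d * \<bar>dist y z - dist x z\<bar> / (dist x z * dist y z) \<le> ?d * ?d / (dist x z * dist y z)"
      by (intro divide_right_mono mult_left_mono) auto
    moreover have "\<bar>?A - ?C\<bar> = ?d * \<bar>dist y z - dist x z\<bar> / (dist x z * dist y z)"
    proof -
      have "?A - ?C = ?d * (dist y z - dist x z) / (dist x z * dist y z)"
        using that by (simp add: field_simps)
      then show ?thesis by (simp add: abs_mult)
    qed
    ultimately have "\<bar>?A - ?C\<bar> \<le> S\<^sup>2" using AC by simp
    then have "(?A - ?C)\<^sup>2 \<le> (S\<^sup>2)\<^sup>2"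
      by (metis abs_ge_zero power2_abs power_mono)
    moreover have "(?A + ?C)\<^sup>2 = (?A - ?C)\<^sup>2 + 4 * (?A * ?C)"
      by algebra
    \<comment> \<open>The estimate so far is S^4 + 4 S^2; the slack 4 S^3 is given away to reach the
      form (1+S)^2 - 1, which suits the logarithm.\<close>
    moreover have "(S\<^sup>2 + 2 * S)\<^sup>2 = (S\<^sup>2)\<^sup>2 + 4 * S\<^sup>2 + 4 * S ^ 3"
      by algebra
    moreover have "S ^ 3 \<ge> 0" using S by simp
    ultimately have "(?A + ?C)\<^sup>2 \<le> (S\<^sup>2 + 2 * S)\<^sup>2" using AC by linarith
    then show ?thesis using S by (meson power2_le_imp_le add_nonneg_nonneg zero_le_power2 mult_nonneg_nonneg zero_le_numeral)
  qed
  \<comment> \<open>The product of the triangle inequalities for \<open>dist p q\<close> through \<open>x\<close> and through \<open>y\<close> reduces the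
    claim to \<open>(A + B) * (C + D) \<le> (S\<^sup>2 + 2 * S)\<^sup>2\<close>; then use AM-GM.\<close>
  let ?A = "?d / dist x p" and ?C = "?d / dist y p" and ?B = "?d / dist x q" and ?D = "?d / dist y q"
  have sum: "?A + ?C \<le> S\<^sup>2 + 2 * S" "?B + ?D \<le> S\<^sup>2 + 2 * S" using * pos p q by auto
  have "dist p q \<le> dist x p + dist x q" "dist p q \<le> dist y p + dist y q"
    by (simp_all add: dist_triangle3)
  then have pq: "dist p q * dist p q \<le> (dist x p + dist x q) * (dist y p + dist y q)"
    by (intro mult_mono) auto
  have "(cross_ratio (Some x) (Some y) (Some p) (Some q))\<^sup>2
      = ?d * ?d * (dist p q * dist p q) / (dist x p * dist y p * dist x q * dist y q)"
    by (simp add: cross_ratio_def power_divide power_mult_distrib power2_eq_square)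
  also have "\<dots> \<le> ?d * ?d * ((dist x p + dist x q) * (dist y p + dist y q)) / (dist x p * dist y p * dist x q * dist y q)"
    by (intro divide_right_mono mult_left_mono pq) auto
  also have "\<dots> = (?A + ?B) * (?C + ?D)"
    using pos by (simp add: field_simps)
  also have "\<dots> \<le> (((?A + ?C) + (?B + ?D)) / 2)\<^sup>2"
  proof -
    have "a * b \<le> ((a + b) / 2)\<^sup>2" for a b :: real
      using zero_le_power2[of "a - b"] by (simp add: power2_eq_square field_simps)
    from this[of "?A + ?B" "?C + ?D"] show ?thesis by (simp add: add.commute add.left_commute add.assoc)
  qed
  also have "\<dots> \<le> (S\<^sup>2 + 2 * S)\<^sup>2"
    using sum by (intro power_mono) (auto intro!: add_nonneg_nonneg divide_nonneg_nonneg)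
  finally show ?thesis using S by (meson power2_le_imp_le add_nonneg_nonneg zero_le_power2 mult_nonneg_nonneg zero_le_numeral)
qed


section \<open>The Cassinian supremum of a convex domain\<close>

text \<open>The nearest-point projection onto the closure of a convex set is 1-Lipschitz and fixes
  the points of \<open>U\<close>, so the projection of \<open>p\<close> serves as
  \<open>c\<close>.\<close>

lemma ex_closer_frontier_point:
  fixes U :: "'a::euclidean_space set"
  assumes "open U" "convex U" "U \<noteq> {}" "p \<notin> U"
  obtains c where "c \<in> frontier U" "\<And>x. x \<in> U \<Longrightarrow> dist x c \<le> dist x p"
proof
  let ?c = "closest_point (closure U) p"
  have int: "interior (closure U) = U"
    using assms by (simp add: convex_interior_closure interior_open)
  have "?c \<in> closure U" using assms by (intro closest_point_in_set) auto
  \<comment> \<open>The affine hull of \<open>U\<close> is the whole space and the relative interior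
    of the closure is \<open>U\<close>; a point outside it is never projected into it.\<close>
  moreover have "?c \<notin> U"
    using closest_point_in_rel_interior[of "closure U" p] assms int
    by (simp add: rel_interior_nonempty_interior affine_hull_nonempty_interior affine_hull_open)
  ultimately show "?c \<in> frontier U" using assms by (simp add: frontier_def interior_open)
  show "dist x ?c \<le> dist x p" if "x \<in> U" for x
  proof -
    have "x \<in> closure U" using that closure_subset by blast
    then show ?thesis
      using closest_point_lipschitz[of "closure U" x p] assms
      by (auto simp: closest_point_self)
  qed
qed

text \<open>Replacing \<open>p\<close> by a frontier point closer to both \<open>x\<close> and
  \<open>y\<close> only increases the quotient, so the supremum over the frontier controls all
  outside points.\<close>

lemma cassinian_sup_upper:
  fixes U :: "'a::euclidean_space set"
  assumes U: "open U" "convex U" and "x \<in> U" "y \<in> U" "p \<notin> U"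
  shows "dist x y / sqrt (dist x p * dist y p) \<le> cassinian_sup U x y"
proof -
  obtain c where c: "c \<in> frontier U" "\<And>z. z \<in> U \<Longrightarrow> dist z c \<le> dist z p"
    using ex_closer_frontier_point assms by (metis empty_iff)
  have out: "z \<notin> U" if "z \<in> frontier U" for z
    using that U by (simp add: frontier_def interior_open)
  have "dist x c > 0" "dist y c > 0" using out[OF c(1)] assms by auto
  moreover have "dist x p > 0" "dist y p > 0" using assms by auto
  ultimately have "dist x y / sqrt (dist x p * dist y p) \<le> dist x y / sqrt (dist x c * dist y c)"
    using c(2) assms by (intro divide_left_mono real_sqrt_le_mono mult_mono mult_pos_pos) simp_all
  also have "\<dots> \<le> cassinian_sup U x y"
    unfolding cassinian_sup_def
  proof (rule cSUP_upper[OF c(1)])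
    \<comment> \<open>The real \<open>SUP\<close> dominates its terms only if they are bounded
      above: balls around \<open>x\<close> and \<open>y\<close> inside \<open>U\<close> keep the
      denominators away from 0.\<close>
    obtain r where r: "r > 0" "ball x r \<subseteq> U" using U(1) assms(3) open_contains_ball by metis
    obtain s where s: "s > 0" "ball y s \<subseteq> U" using U(1) assms(4) open_contains_ball by metis
    have "dist x y / sqrt (dist x z * dist y z) \<le> dist x y / sqrt (r * s)" if "z \<in> frontier U" for z
    proof -
      have "r \<le> dist x z" "s \<le> dist y z" using out[OF that] r(2) s(2) by (force simp: not_le)+
      then show ?thesis using r(1) s(1)
        by (intro divide_left_mono real_sqrt_le_mono mult_mono) (auto intro!: mult_pos_pos simp del: zero_less_dist_iff)
    qed
    then show "bdd_above ((\<lambda>p. dist x y / sqrt (dist x p * dist y p)) ` frontier U)"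
      by (intro bdd_aboveI2)
  qed
  finally show ?thesis .
qed

text \<open>The frontier of an open set lies in its complement. It has to be non-empty, as the
  supremum of the empty set carries no information.\<close>

lemma cassinian_sup_least:
  fixes U :: "'a::euclidean_space set"
  assumes "open U" "U \<noteq> {}" "U \<noteq> UNIV"
    and "\<And>p. p \<notin> U \<Longrightarrow> dist x y / sqrt (dist x p * dist y p) \<le> M"
  shows "cassinian_sup U x y \<le> M"
  unfolding cassinian_sup_def
proof (rule cSUP_least)
  show "frontier U \<noteq> {}" using assms frontier_eq_empty by blast
qed (use assms in \<open>auto simp: frontier_def interior_open\<close>)

lemma cassinian_sup_nonneg:
  fixes U :: "'a::euclidean_space set"
  assumes "open U" "convex U" "U \<noteq> UNIV" "x \<in> U" "y \<in> U"
  shows "cassinian_sup U x y \<ge> 0"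
proof -
  obtain p where "p \<notin> U" using assms by auto
  then show ?thesis
    using cassinian_sup_upper[OF assms(1,2,4,5)]
    by (meson order_trans divide_nonneg_nonneg real_sqrt_ge_zero mult_nonneg_nonneg zero_le_dist)
qed

lemma cassinian_sup_pos:
  fixes U :: "'a::euclidean_space set"
  assumes "open U" "convex U" "U \<noteq> UNIV" "x \<in> U" "y \<in> U" "x \<noteq> y"
  shows "cassinian_sup U x y > 0"
proof -
  obtain p where p: "p \<notin> U" using assms by auto
  then have "x \<noteq> p" "y \<noteq> p" using assms by auto
  then have "0 < dist x y / sqrt (dist x p * dist y p)"
    using assms by simp
  also have "\<dots> \<le> cassinian_sup U x y"
    using cassinian_sup_upper p assms by blast
  finally show ?thesis .
qed

lemma cross_ratio_le_cassinian_sup: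
  fixes U :: "'a::euclidean_space set"
  assumes U: "open U" "convex U" "U \<noteq> UNIV" and xy: "x \<in> U" "y \<in> U"
    and pq: "p \<notin> Some ` U" "q \<notin> Some ` U"
  shows "cross_ratio (Some x) (Some y) p q \<le> (cassinian_sup U x y)\<^sup>2 + 2 * cassinian_sup U x y"
proof -
  let ?S = "cassinian_sup U x y"
  have S: "?S \<ge> 0" using cassinian_sup_nonneg assms by blast
  then have le: "?S \<le> ?S\<^sup>2 + 2 * ?S" by (smt (verit) zero_le_power2)
  have term_le: "dist x y / sqrt (dist x z * dist y z) \<le> ?S" if "Some z \<notin> Some ` U" for z
    using that by (intro cassinian_sup_upper assms) auto
  show ?thesis
  proof (cases p; cases q)
    fix a b assume "p = Some a" "q = Some b"
    then show ?thesis
      using cross_ratio_bound[of x a y b ?S] term_le pq xy by auto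
  next
    fix a assume "p = Some a" "q = None"
    then show ?thesis using term_le[of a] pq le by (simp add: cross_ratio_def)
  next
    fix b assume "p = None" "q = Some b"
    then show ?thesis using term_le[of b] pq le by (simp add: cross_ratio_def)
  next
    assume "p = None" "q = None"
    then show ?thesis using S by (simp add: cross_ratio_def)
  qed
qed

section \<open>Transfer along a bijection that preserves cross ratios\<close>

text \<open>The assumptions are symmetric in \<open>f\<close> and its inverse, so each result
  applies in both directions without a proof that the inverse is Moebius.\<close>

locale cross_ratio_preserving =
  fixes f :: "'a::euclidean_space option \<Rightarrow> 'a option" and U V :: "'a set"
  assumes bij: "bij f"
    and cross_ratio_eq: "\<And>u v p q. cross_ratio (f u) (f v) (f p) (f q) = cross_ratio u v p q"
    and image: "f ` Some ` U = Some ` V"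
    and U: "open U" "convex U" "U \<noteq> UNIV"
    and V: "open V" "convex V" "V \<noteq> UNIV"
begin

lemma inv_preserving: "cross_ratio_preserving (inv f) V U"
proof
  show "bij (inv f)" using bij by (rule bij_imp_bij_inv)
  show "inv f ` Some ` V = Some ` U"
    using image bij by (metis bij_def image_inv_f_f)
  show "cross_ratio (inv f u) (inv f v) (inv f p) (inv f q) = cross_ratio u v p q" for u v p q
    using cross_ratio_eq bij by (metis bij_inv_eq_iff)
qed (use U V in auto)

lemma f_Some:
  assumes "x \<in> U"
  shows "f (Some x) = Some (the (f (Some x)))" "the (f (Some x)) \<in> V"
proof -
  have "f (Some x) \<in> Some ` V" using image assms by blast
  then show "f (Some x) = Some (the (f (Some x)))" "the (f (Some x)) \<in> V" by auto
qed

lemma mem_image_iff: "f u \<in> Some ` V \<longleftrightarrow> u \<in> Some ` U"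
  using image bij by (metis bij_def inj_image_mem_iff)

text \<open>Cassinian terms in \<open>V\<close> are cross ratios with fourth point infinity; pulled
  back by \<open>f\<close> they are cross ratios with fourth point \<open>pole\<close>. Hence the
  supremum for \<open>V\<close> is computed in \<open>U\<close>.\<close>

definition pole where "pole = inv f None"

lemma f_pole: "f pole = None"
  unfolding pole_def using bij by (metis bij_inv_eq_iff)

lemma pole_not_in: "pole \<notin> Some ` U"
  using mem_image_iff[of pole] by (auto simp: f_pole)

lemma cassinian_sup_image_upper:
  assumes "x \<in> U" "y \<in> U" "p \<notin> Some ` U"
  shows "cross_ratio (Some x) (Some y) p pole \<le> cassinian_sup V (the (f (Some x))) (the (f (Some y)))"
proof (cases "f p")
  case None
  then have "p = pole" using f_pole bij by (metis bij_def inj_eq)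
  then show ?thesis using cassinian_sup_nonneg[OF V] f_Some assms
    by (simp add: cross_ratio_def hdist_eq_0_iff[THEN iffD2])
next
  case (Some z)
  have "z \<notin> V" using mem_image_iff[of p] assms(3) Some by auto
  then have "cross_ratio (Some (the (f (Some x)))) (Some (the (f (Some y)))) (Some z) None
      \<le> cassinian_sup V (the (f (Some x))) (the (f (Some y)))"
    using cassinian_sup_upper[OF V(1,2) f_Some(2) f_Some(2)] assms by (simp add: cross_ratio_def)
  then show ?thesis using assms by (metis cross_ratio_eq f_Some(1) f_pole Some)
qed

lemma cassinian_sup_image_least:
  assumes "x \<in> U" "y \<in> U"
    and M: "\<And>p. p \<notin> Some ` U \<Longrightarrow> cross_ratio (Some x) (Some y) p pole \<le> M"
  shows "cassinian_sup V (the (f (Some x))) (the (f (Some y))) \<le> M"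
proof (rule cassinian_sup_least)
  fix z assume z: "z \<notin> V"
  obtain p where p: "f p = Some z" using bij by (metis bij_pointE)
  then have "cross_ratio (Some x) (Some y) p pole \<le> M"
    using mem_image_iff[of p] z by (intro M) auto
  moreover have "cross_ratio (Some x) (Some y) p pole
      = cross_ratio (Some (the (f (Some x)))) (Some (the (f (Some y)))) (Some z) None"
    using assms by (metis cross_ratio_eq f_Some(1) f_pole p)
  ultimately show "dist (the (f (Some x))) (the (f (Some y))) /
      sqrt (dist (the (f (Some x))) z * dist (the (f (Some y))) z) \<le> M"
    by (simp add: cross_ratio_def)
qed (use V f_Some(2) assms in auto)

lemma cassinian_tilde_image_le:
  assumes "x \<in> U" "y \<in> U"
  shows "cassinian_tilde V (the (f (Some x))) (the (f (Some y))) \<le> 2 * cassinian_tilde U x y"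
proof -
  let ?S = "cassinian_sup U x y" and ?T = "cassinian_sup V (the (f (Some x))) (the (f (Some y)))"
  have S: "?S \<ge> 0" "?T \<ge> 0"
    using cassinian_sup_nonneg[OF U assms] cassinian_sup_nonneg[OF V f_Some(2) f_Some(2)] assms by auto
  \<comment> \<open>The pole is one admissible fourth point outside \<open>U\<close>, so the
    four-point bound covers every pulled-back term.\<close>
  have "?T \<le> ?S\<^sup>2 + 2 * ?S"
    using cross_ratio_le_cassinian_sup[OF U assms] pole_not_in by (intro cassinian_sup_image_least assms)
  then have "1 + ?T \<le> (1 + ?S)\<^sup>2" by (simp add: power2_eq_square algebra_simps)
  then have "ln (1 + ?T) \<le> ln ((1 + ?S)\<^sup>2)" using S by (intro ln_mono) auto
  also have "\<dots> = 2 * ln (1 + ?S)" using S by (simp add: ln_realpow)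
  finally show ?thesis by (simp add: cassinian_tilde_eq)
qed

lemma cassinian_tilde_le_image:
  assumes "x \<in> U" "y \<in> U"
  shows "cassinian_tilde U x y \<le> 2 * cassinian_tilde V (the (f (Some x))) (the (f (Some y)))"
proof -
  interpret inv: cross_ratio_preserving "inv f" V U by (rule inv_preserving)
  have "inv f (Some (the (f (Some z)))) = Some z" if "z \<in> U" for z
    using f_Some(1)[OF that] bij by (metis bij_inv_eq_iff)
  then show ?thesis
    using inv.cassinian_tilde_image_le[of "the (f (Some x))" "the (f (Some y))"] f_Some(2) assms by simp
qed

end


section \<open>Half-space, ball and the position of the pole\<close>

lemma upper_half_open_convex:
  shows "open (upper_half :: (real^'n::{finite,linorder}) set)"
    and "convex (upper_half :: (real^'n::{finite,linorder}) set)"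
    and "(upper_half :: (real^'n::{finite,linorder}) set) \<noteq> UNIV"
proof -
  let ?e = "axis (Max UNIV) 1 :: real^'n::{finite,linorder}"
  have *: "upper_half = {x. inner ?e x > 0}"
    by (auto simp: upper_half_def inner_axis')
  show "open (upper_half :: (real^'n::{finite,linorder}) set)" "convex (upper_half :: (real^'n::{finite,linorder}) set)"
    unfolding * by (rule open_halfspace_gt convex_halfspace_gt)+
  have "(0 :: real^'n::{finite,linorder}) \<notin> upper_half" by (simp add: upper_half_def)
  then show "(upper_half :: (real^'n::{finite,linorder}) set) \<noteq> UNIV" by blast
qed

lemma unit_ball_open_convex:
  shows "open (unit_ball :: (real^'n::finite) set)"
    and "convex (unit_ball :: (real^'n::finite) set)"
    and "(unit_ball :: (real^'n::finite) set) \<noteq> UNIV"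
proof -
  have *: "unit_ball = (ball 0 1 :: (real^'n::finite) set)"
    by (auto simp: unit_ball_def)
  show "open (unit_ball :: (real^'n::finite) set)" "convex (unit_ball :: (real^'n::finite) set)"
    unfolding * by auto
  show "(unit_ball :: (real^'n::finite) set) \<noteq> UNIV" unfolding * by (metis bounded_ball not_bounded_UNIV)
qed

lemma mobius_cross_ratio_preserving:
  fixes f :: "(real^'n::{finite,linorder}) option \<Rightarrow> (real^'n::{finite,linorder}) option"
  assumes "mobius f" "f ` (Some ` upper_half) = Some ` unit_ball"
  shows "cross_ratio_preserving f upper_half unit_ball"
  using assms
  by unfold_locales
    (simp_all add: mobius_bij mobius_cross_ratio upper_half_open_convex unit_ball_open_convex)

text \<open>With the pole at infinity \<open>f\<close> would scale all distances in the half-space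
  by a constant, but the ball is bounded. For a finite pole, approaching it would send images to
  infinity, again against boundedness. The margin \<open>d\<close> makes the later estimates
  uniform.\<close>

lemma mobius_half_ball_pole:
  fixes f :: "(real^'n::{finite,linorder}) option \<Rightarrow> (real^'n::{finite,linorder}) option"
  assumes f: "mobius f" "f ` (Some ` upper_half) = Some ` unit_ball"
  obtains c d where "cross_ratio_preserving.pole f = Some c" "d > 0"
    "\<And>x. x \<in> upper_half \<Longrightarrow> dist x c \<ge> d"
proof -
  interpret cross_ratio_preserving f upper_half unit_ball
    using f by (rule mobius_cross_ratio_preserving)
  obtain l where l: "\<And>u. l u > 0" "\<And>u v. hdist (f u) (f v) = l u * l v * hdist u v"
    using mobius_hdist[OF f(1)] by blast
  have ball: "norm (the (f (Some x))) < 1" if "x \<in> upper_half" for x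
    using f_Some(2)[OF that] by (simp add: unit_ball_def)
  have fpole: "l (Some x) * l pole * hdist (Some x) pole = 1" if "x \<in> upper_half" for x
    using l(2)[of "Some x" pole] f_pole f_Some(1)[OF that] by (metis hdist_simps(3))
  have "pole \<noteq> None"
  proof
    assume None: "pole = None"
    \<comment> \<open>\<open>?k\<close> is the scaling constant, and \<open>?y\<close> lies at
      distance \<open>2 / ?k\<close> from \<open>?e\<close>: the images would be 2 apart, which the
      open unit ball does not allow.\<close>
    let ?e = "axis (Max UNIV) 1 :: real^'n::{finite,linorder}" and ?k = "(1 / l None)\<^sup>2"
    let ?y = "(1 + 2 / ?k) *\<^sub>R ?e"
    have k: "?k > 0" using l(1)[of None] by simp
    have mem: "?e \<in> upper_half" "?y \<in> upper_half"
      using k by (auto simp: upper_half_def add_pos_pos)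
    have "l (Some x) = 1 / l None" if "x \<in> upper_half" for x
      using fpole[OF that] None l(1)[of None] by (simp add: field_simps)
    then have "hdist (f (Some ?e)) (f (Some ?y)) = ?k * dist ?e ?y"
      using l(2)[of "Some ?e" "Some ?y"] mem by (simp add: power2_eq_square)
    also have "?e - ?y = (- (2 / ?k)) *\<^sub>R ?e" by (simp add: algebra_simps)
    then have "dist ?e ?y = 2 / ?k" using k by (simp add: dist_norm norm_axis_1)
    then have "?k * dist ?e ?y = 2" using k by simp
    finally have "dist (the (f (Some ?e))) (the (f (Some ?y))) = 2"
      using f_Some(1) mem by (metis hdist_simps(4))
    moreover have "dist (the (f (Some ?e))) (the (f (Some ?y))) < 1 + 1"
      unfolding dist_norm
      using norm_triangle_ineq4[of "the (f (Some ?e))" "the (f (Some ?y))"] ball[OF mem(1)] ball[OF mem(2)] by linarith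
    ultimately show False by simp
  qed
  then obtain c where c: "pole = Some c" by blast
  have "f None \<noteq> None" using f_pole bij c by (metis bij_def inj_eq option.distinct(1))
  then obtain w where w: "f None = Some w" by blast
  show ?thesis
  proof (rule that[OF c])
    show d: "l None / l pole / (1 + norm w) > 0"
      using l(1) by (intro divide_pos_pos) (auto intro: add_pos_nonneg)
    fix x :: "real^'n::{finite,linorder}" assume x: "x \<in> upper_half"
    let ?x = "the (f (Some x))"
    have "hdist (f (Some x)) (f None) = l (Some x) * l None"
      using l(2)[of "Some x" None] by simp
    then have "dist ?x w = l (Some x) * l None"
      using w f_Some(1)[OF x] by (metis hdist_simps(4))
    \<comment> \<open>Eliminating the weight of \<open>x\<close> leaves a product independent of
      \<open>x\<close>; a bound on its first factor bounds the second from below.\<close>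
    then have "dist ?x w * dist x c = l None / l pole"
      using fpole[OF x] l(1)[of pole] c by (simp add: field_simps)
    moreover have "dist ?x w \<le> 1 + norm w"
      using ball[OF x] norm_triangle_ineq4[of ?x w] by (simp add: dist_norm)
    ultimately have "l None / l pole \<le> (1 + norm w) * dist x c"
      by (metis mult_right_mono zero_le_dist)
    then show "l None / l pole / (1 + norm w) \<le> dist x c"
      by (subst pos_divide_le_eq) (auto intro: add_pos_nonneg simp: mult.commute)
  qed
qed

section \<open>Two extremal families of pairs\<close>

text \<open>As \<open>T\<close> grows, a boundary point of the half-space stays near at most one of
  \<open>x\<close> and \<open>y\<close>. For the ball the pole is a second base point, near
  \<open>x\<close> while \<open>p\<close> is near \<open>y\<close>, which gains a further factor of
  order sqrt T.\<close>

lemma cassinian_sup_horizontal: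
  fixes f :: "(real^'n::{finite,linorder}) option \<Rightarrow> (real^'n::{finite,linorder}) option"
  assumes f: "mobius f" "f ` (Some ` upper_half) = Some ` unit_ball"
    and pole: "cross_ratio_preserving.pole f = Some c"
    and i: "i \<noteq> Max UNIV" and T: "T > norm c"
  defines "x \<equiv> axis (Max UNIV) 1 :: real^'n::{finite,linorder}"
  defines "y \<equiv> x + T *\<^sub>R axis i 1"
  shows "x \<in> upper_half" "y \<in> upper_half" "x \<noteq> y"
    and "cassinian_sup upper_half x y \<le> sqrt (2 * T)"
    and "T * (T - norm c) / (sqrt (1 + norm c) * (T + 1 + norm c))
      \<le> cassinian_sup unit_ball (the (f (Some x))) (the (f (Some y)))"
proof -
  interpret cross_ratio_preserving f upper_half unit_ball
    using f by (rule mobius_cross_ratio_preserving)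
  have T0: "T > 0" using T norm_ge_zero[of c] by linarith
  have comp: "x $ Max UNIV = 1" "y $ Max UNIV = 1"
    using i by (simp_all add: x_def y_def axis_def)
  show xy: "x \<in> upper_half" "y \<in> upper_half" using comp by (auto simp: upper_half_def)
  have dxy: "dist x y = T" using T0 by (simp add: y_def dist_norm norm_axis_1)
  then show "x \<noteq> y" using T0 by auto
  show "cassinian_sup upper_half x y \<le> sqrt (2 * T)"
  proof (rule cassinian_sup_least)
    fix p :: "real^'n::{finite,linorder}" assume "p \<notin> upper_half"
    then have p: "p $ Max UNIV \<le> 0" by (auto simp: upper_half_def)
    have "1 \<le> dist x p" "1 \<le> dist y p"
      using component_le_norm_cart[of "x - p" "Max UNIV"] component_le_norm_cart[of "y - p" "Max UNIV"] p comp
      by (auto simp: dist_norm)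
    moreover have "T \<le> dist x p + dist y p" using dist_triangle2[of x y p] dxy by simp
    \<comment> \<open>For a, b \<ge> 1 the product is at least a + b - 1 \<ge> T - 1 and at least 1;
      \<open>T / 2\<close> is the average of \<open>T - 1\<close> and 1.\<close>
    ultimately have prod: "T / 2 \<le> dist x p * dist y p"
    proof -
      assume a: "1 \<le> dist x p" "1 \<le> dist y p" and b: "T \<le> dist x p + dist y p"
      have "(dist x p - 1) * (dist y p - 1) \<ge> 0" using a by simp
      then have "dist x p * dist y p \<ge> dist x p + dist y p - 1" by (simp add: algebra_simps)
      moreover have "dist x p * dist y p \<ge> 1" using mult_mono[OF a] by simp
      ultimately show ?thesis using b by linarith
    qed
    have "dist x y / sqrt (dist x p * dist y p) \<le> T / sqrt (T / 2)"
      unfolding dxy using prod T0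
      by (intro divide_left_mono real_sqrt_le_mono mult_pos_pos) (auto intro: less_le_trans[of 0 "T / 2"])
    also have "\<dots> = sqrt (2 * T)"
    proof -
      have "T = sqrt (2 * T) * sqrt (T / 2)" using T0 by (simp flip: real_sqrt_mult)
      then show ?thesis using T0 by (simp add: divide_eq_eq)
    qed
    finally show "dist x y / sqrt (dist x p * dist y p) \<le> sqrt (2 * T)" .
  qed (use U xy in auto)
  \<comment> \<open>The foot of \<open>y\<close> on the boundary hyperplane: |y-p| = 1, while |x-p|,
    |y-c| and |p-c| are of order \<open>T\<close>, so the cross ratio grows linearly.\<close>
  define p where "p = T *\<^sub>R axis i (1::real)"
  have "p \<notin> upper_half" using i by (simp add: p_def upper_half_def axis_def)
  have np: "norm p = T" using T0 by (simp add: p_def norm_axis_1)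
  have nx: "norm x = 1" by (simp add: x_def norm_axis_1)
  have yp: "y = x + p" by (simp add: y_def p_def)
  have pos: "dist x p > 0" "dist y p > 0" "dist x c > 0" "dist y c > 0"
    using xy \<open>p \<notin> upper_half\<close> pole_not_in pole by auto
  \<comment> \<open>The bound for |x-p| is weakened to the one for |y-c|, so that their product is a
    square under the root.\<close>
  have le: "dist x p \<le> T + 1 + norm c" "dist y p = 1" "dist x c \<le> 1 + norm c" "dist y c \<le> T + 1 + norm c"
    using norm_triangle_ineq4[of x p] norm_triangle_ineq4[of x c] norm_triangle_ineq4[of y c]
      norm_triangle_ineq[of x p] nx np norm_ge_zero[of c]
    unfolding dist_norm yp by (simp_all del: norm_ge_zero)
  have "sqrt (dist x p * dist y p * dist x c * dist y c)
      \<le> sqrt ((T + 1 + norm c) * 1 * (1 + norm c) * (T + 1 + norm c))"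
    using pos le T0 by (intro real_sqrt_le_mono mult_mono) auto
  also have "\<dots> = sqrt ((1 + norm c) * (T + 1 + norm c)\<^sup>2)"
    by (rule arg_cong[of _ _ sqrt]) (simp add: power2_eq_square)
  also have "\<dots> = sqrt (1 + norm c) * (T + 1 + norm c)"
    using T0 by (simp add: real_sqrt_mult)
  finally have den: "sqrt (dist x p * dist y p * dist x c * dist y c) \<le> sqrt (1 + norm c) * (T + 1 + norm c)" .
  have "T - norm c \<le> dist p c" using norm_triangle_ineq2[of p c] np by (simp add: dist_norm)
  then have "T * (T - norm c) / (sqrt (1 + norm c) * (T + 1 + norm c))
      \<le> T * dist p c / sqrt (dist x p * dist y p * dist x c * dist y c)"
    using den pos T T0 by (intro frac_le mult_left_mono) auto
  also have "\<dots> = cross_ratio (Some x) (Some y) (Some p) pole"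
    by (simp add: cross_ratio_def pole dxy)
  also have "\<dots> \<le> cassinian_sup unit_ball (the (f (Some x))) (the (f (Some y)))"
    using \<open>p \<notin> upper_half\<close> xy by (intro cassinian_sup_image_upper) auto
  finally show "T * (T - norm c) / (sqrt (1 + norm c) * (T + 1 + norm c))
      \<le> cassinian_sup unit_ball (the (f (Some x))) (the (f (Some y)))" .
qed

text \<open>In the half-space the boundary point 0 has |x||y| = 1, so its term is |x-y|. For the
  ball the pole keeps distance \<open>d\<close> from \<open>x\<close> even as \<open>x\<close> tends
  to 0, so |x-c||y-c| \<ge> d s costs a factor of order sqrt s. The constant \<open>k\<close> bounds
  |x-c|, as |x| < 1.\<close>

lemma cassinian_sup_vertical:
  fixes f :: "(real^'n::{finite,linorder}) option \<Rightarrow> (real^'n::{finite,linorder}) option"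
  assumes f: "mobius f" "f ` (Some ` upper_half) = Some ` unit_ball"
    and pole: "cross_ratio_preserving.pole f = Some c"
    and d: "d > 0" "\<And>x. x \<in> upper_half \<Longrightarrow> dist x c \<ge> d"
    and s: "s > 1"
  defines "x \<equiv> (1 / s) *\<^sub>R axis (Max UNIV) 1 :: real^'n::{finite,linorder}"
  defines "y \<equiv> s *\<^sub>R axis (Max UNIV) 1 :: real^'n::{finite,linorder}"
  defines "k \<equiv> 1 + norm c"
  shows "x \<in> upper_half" "y \<in> upper_half" "x \<noteq> y"
    and "s - 1 / s \<le> cassinian_sup upper_half x y"
    and "cassinian_sup unit_ball (the (f (Some x))) (the (f (Some y))) \<le> sqrt ((2 + 2 * k + k\<^sup>2) / d * s)"
proof -
  interpret cross_ratio_preserving f upper_half unit_ball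
    using f by (rule mobius_cross_ratio_preserving)
  have s1: "1 / s < 1" "1 / s > 0" "s > 0" using s by auto
  have comp: "x $ Max UNIV = 1 / s" "y $ Max UNIV = s"
    by (simp_all add: x_def y_def)
  have nx: "norm x = 1 / s" "norm y = s" using s by (simp_all add: x_def y_def norm_axis_1)
  show xy: "x \<in> upper_half" "y \<in> upper_half" using comp s by (auto simp: upper_half_def)
  show "x \<noteq> y" using nx s1 s by force
  have "x - y = (1 / s - s) *\<^sub>R axis (Max UNIV) 1" by (simp add: x_def y_def scaleR_left_diff_distrib)
  moreover have "\<bar>1 / s - s\<bar> = s - 1 / s" using s1 s by linarith
  ultimately have dxy: "dist x y = s - 1 / s" by (simp add: dist_norm norm_axis_1)
  have "0 \<notin> (upper_half :: (real^'n::{finite,linorder}) set)" by (simp add: upper_half_def)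
  from cassinian_sup_upper[OF U(1,2) xy this]
  show "s - 1 / s \<le> cassinian_sup upper_half x y"
    using s by (simp add: dxy nx)
  have k: "k \<ge> 1" by (simp add: k_def)
  have low: "1 / s \<le> dist x p" "s \<le> dist y p" if "p \<notin> upper_half" for p
  proof -
    have "p $ Max UNIV \<le> 0" using that by (auto simp: upper_half_def)
    then show "1 / s \<le> dist x p" "s \<le> dist y p"
      using component_le_norm_cart[of "x - p" "Max UNIV"] component_le_norm_cart[of "y - p" "Max UNIV"] comp s1
      by (auto simp: dist_norm)
  qed
  have c: "c \<notin> upper_half" using pole_not_in pole by auto
  have xc: "d \<le> dist x c" "dist x c \<le> k"
    using d(2)[OF xy(1)] norm_triangle_ineq4[of x c] s1(1) nx(1) unfolding k_def dist_norm by linarith+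
  have yc: "s \<le> dist y c" using low c by blast
  have dle: "dist x y \<le> s" using dxy s1 by linarith
  show "cassinian_sup unit_ball (the (f (Some x))) (the (f (Some y))) \<le> sqrt ((2 + 2 * k + k\<^sup>2) / d * s)"
  proof (rule cassinian_sup_image_least[OF xy])
    fix p assume p: "p \<notin> Some ` (upper_half :: (real^'n::{finite,linorder}) set)"
    define A where "A = hdist (Some x) p * hdist (Some y) p"
    \<comment> \<open>The constant must not depend on \<open>s\<close>. For finite \<open>p\<close>,
      expand |p-c|^2 \<le> (X + k)^2 with X = |x-p| and Y = |y-p|; by X \<le> 2 Y, Y \<ge> 1 and X Y
      \<ge> 1 its three terms are at most 2, 2 k and k^2 times X Y.\<close>
    have main: "A > 0 \<and> (hdist p pole)\<^sup>2 \<le> (2 + 2 * k + k\<^sup>2) * A"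
    proof (cases p)
      case None
      then show ?thesis using k by (simp add: A_def pole)
    next
      case (Some z)
      have z: "1 / s \<le> dist x z" "s \<le> dist y z" using low p Some by auto
      let ?X = "dist x z" and ?Y = "dist y z"
      have X: "?X > 0" "?Y \<ge> 1" using z s1 s by linarith+
      have A1: "?X * ?Y \<ge> 1" using mult_mono[OF z] s1 by simp
      have "?X \<le> ?Y + s" using dist_triangle[of x z y] dle by linarith
      then have "?X \<le> 2 * ?Y" using z by linarith
      then have 1: "?X * ?X \<le> ?X * (2 * ?Y)" using X by (intro mult_left_mono) auto
      have 2: "2 * k * ?X \<le> 2 * k * (?X * ?Y)" using X k by (intro mult_left_mono) auto
      have 3: "k\<^sup>2 * 1 \<le> k\<^sup>2 * (?X * ?Y)" using A1 by (intro mult_left_mono) auto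
      have "dist z c \<le> ?X + k" using dist_triangle3[of z c x] xc by linarith
      then have "(dist z c)\<^sup>2 \<le> (?X + k)\<^sup>2" by (intro power_mono) auto
      also have "\<dots> = ?X * ?X + 2 * k * ?X + k\<^sup>2 * 1" by (simp add: power2_eq_square algebra_simps)
      also have "\<dots> \<le> ?X * (2 * ?Y) + 2 * k * (?X * ?Y) + k\<^sup>2 * (?X * ?Y)" using 1 2 3 by linarith
      also have "\<dots> = (2 + 2 * k + k\<^sup>2) * (?X * ?Y)" by (simp add: algebra_simps)
      finally show ?thesis using Some X A1 by (simp add: A_def pole)
    qed
    have "(cross_ratio (Some x) (Some y) p pole)\<^sup>2
        = (dist x y)\<^sup>2 * (hdist p pole)\<^sup>2 / (A * (dist x c * dist y c))"
    proof -
      have "hdist (Some x) p * hdist (Some y) p * hdist (Some x) pole * hdist (Some y) pole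
          = A * (dist x c * dist y c)" by (simp add: A_def pole)
      moreover have "A * (dist x c * dist y c) \<ge> 0" using main by simp
      ultimately show ?thesis
        by (simp only: cross_ratio_def power_divide power_mult_distrib real_sqrt_pow2 hdist_simps)
    qed
    \<comment> \<open>After \<open>A\<close> cancels, |x-y|^2 \<le> s^2 against |x-c||y-c| \<ge> d s
      leaves order \<open>s\<close>.\<close>
    also have "\<dots> \<le> s\<^sup>2 * ((2 + 2 * k + k\<^sup>2) * A) / (A * (d * s))"
      using main dle xc yc d s1 by (intro frac_le mult_mono power_mono mult_pos_pos mult_nonneg_nonneg) auto
    also have "\<dots> = (2 + 2 * k + k\<^sup>2) / d * s"
      using main d s1 by (simp add: field_simps power2_eq_square)
    finally show "cross_ratio (Some x) (Some y) p pole \<le> sqrt ((2 + 2 * k + k\<^sup>2) / d * s)"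
      by (rule real_le_rsqrt)
  qed
qed

section \<open>The two inequalities and the sharpness of their constants\<close>

theorem theorem5p3:
  fixes f :: "(real^'n::{finite,linorder}) option \<Rightarrow> (real^'n::{finite,linorder}) option"
  assumes "CARD('n) \<ge> 2"
    and "mobius f"
    and "f ` (Some ` upper_half) = Some ` unit_ball"
  shows "(\<forall>x\<in>upper_half. \<forall>y\<in>upper_half.
            cassinian_tilde upper_half x y / 2
              \<le> cassinian_tilde unit_ball (the (f (Some x))) (the (f (Some y)))
          \<and> cassinian_tilde unit_ball (the (f (Some x))) (the (f (Some y)))
              \<le> 2 * cassinian_tilde upper_half x y)
       \<and> Inf {cassinian_tilde unit_ball (the (f (Some x))) (the (f (Some y)))
               / cassinian_tilde upper_half x y
             | x y. x \<in> upper_half \<and> y \<in> upper_half \<and> x \<noteq> y} = 1 / 2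
       \<and> Sup {cassinian_tilde unit_ball (the (f (Some x))) (the (f (Some y)))
               / cassinian_tilde upper_half x y
             | x y. x \<in> upper_half \<and> y \<in> upper_half \<and> x \<noteq> y} = 2"
proof -
  interpret cross_ratio_preserving f upper_half unit_ball
    using assms(2,3) by (rule mobius_cross_ratio_preserving)
  let ?B = "\<lambda>x y. cassinian_tilde unit_ball (the (f (Some x))) (the (f (Some y)))"
  let ?H = "\<lambda>x y. cassinian_tilde (upper_half :: (real^'n::{finite,linorder}) set) x y"
  let ?SB = "\<lambda>x y. cassinian_sup unit_ball (the (f (Some x))) (the (f (Some y)))"
  let ?SH = "\<lambda>x y. cassinian_sup (upper_half :: (real^'n::{finite,linorder}) set) x y"
  let ?R = "{?B x y / ?H x y | x y. x \<in> upper_half \<and> y \<in> upper_half \<and> x \<noteq> y}"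
  have bounds: "?H x y / 2 \<le> ?B x y \<and> ?B x y \<le> 2 * ?H x y" if "x \<in> upper_half" "y \<in> upper_half" for x y
    using cassinian_tilde_image_le cassinian_tilde_le_image that by fastforce
  have SH: "?SH x y > 0" if "x \<in> upper_half" "y \<in> upper_half" "x \<noteq> y" for x y
    using cassinian_sup_pos U that by blast
  have SB: "?SB x y \<ge> 0" if "x \<in> upper_half" "y \<in> upper_half" for x y
    using cassinian_sup_nonneg[OF V f_Some(2) f_Some(2)] that by blast
  have ratio: "1 / 2 \<le> r \<and> r \<le> 2" if r: "r \<in> ?R" for r
  proof -
    obtain x y where xy: "r = ?B x y / ?H x y" "x \<in> upper_half" "y \<in> upper_half" "x \<noteq> y"
      using r by blast
    have "?H x y > 0" using SH[OF xy(2-)] by (simp add: cassinian_tilde_eq)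
    then show ?thesis using bounds[OF xy(2,3)] by (simp add: xy(1) field_simps)
  qed
  obtain c d where c: "pole = Some c" and d: "d > 0" "\<And>x. x \<in> upper_half \<Longrightarrow> dist x c \<ge> d"
    using mobius_half_ball_pole[OF assms(2,3)] by blast
  \<comment> \<open>Dimension at least 2 provides a direction parallel to the boundary
    hyperplane.\<close>
  obtain i :: "'n::{finite,linorder}" where i: "i \<noteq> Max UNIV"
  proof -
    have "\<not> UNIV \<subseteq> {Max UNIV :: 'n}"
      using card_mono[of "{Max UNIV :: 'n}" UNIV] assms(1) by auto
    then show thesis using that by blast
  qed
  note hor = cassinian_sup_horizontal[OF assms(2,3) c i]
  note vert = cassinian_sup_vertical[OF assms(2,3) c d]
  have nonempty: "?R \<noteq> {}" using hor(1-3)[OF less_add_one] by blast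
  have Sup: "Sup ?R = 2"
  proof (rule cSup_eq_non_empty[OF nonempty])
    fix b assume b: "\<And>r. r \<in> ?R \<Longrightarrow> r \<le> b"
    define Q where "Q = norm c"
    define K where "K = sqrt (1 + norm c)"
    have QK: "Q \<ge> 0" "K > 0" by (auto simp: Q_def K_def add_pos_nonneg)
    \<comment> \<open>A lower bound for the ratio on the horizontal pairs: the numerator behaves
      like ln T, the denominator like (ln T) / 2.\<close>
    let ?g = "\<lambda>T. ln (1 + T * (T - Q) / (K * (T + 1 + Q))) / ln (1 + sqrt (2 * T))"
    have "(?g \<longlongrightarrow> 2) at_top" using QK by real_asymp
    moreover have "\<forall>\<^sub>F T in at_top. ?g T \<le> b"
      using eventually_gt_at_top[of Q]
    proof eventually_elim
      case (elim T)
      then have T: "T > norm c" by (simp add: Q_def)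
      define x where "x = (axis (Max UNIV) 1 :: real^'n::{finite,linorder})"
      define y where "y = x + T *\<^sub>R axis i 1"
      note h = hor[OF T, folded x_def, folded y_def, folded Q_def K_def]
      have g0: "T * (T - Q) / (K * (T + 1 + Q)) \<ge> 0"
        using elim QK by (intro divide_nonneg_nonneg mult_nonneg_nonneg) auto
      have "?g T \<le> ?B x y / ?H x y"
        unfolding cassinian_tilde_eq
        using h g0 SH[OF h(1-3)] by (intro frac_le) auto
      also have "\<dots> \<le> b" using h(1-3) by (intro b) blast
      finally show ?case .
    qed
    ultimately show "2 \<le> b" by (rule tendsto_upperbound) simp
  qed (use ratio in blast)
  have Inf: "Inf ?R = 1 / 2"
  proof (rule cInf_eq_non_empty[OF nonempty])
    fix b assume b: "\<And>r. r \<in> ?R \<Longrightarrow> b \<le> r"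
    define C where "C = (2 + 2 * (1 + norm c) + (1 + norm c)\<^sup>2) / d"
    have C: "C > 0" unfolding C_def using d
      by (intro divide_pos_pos add_pos_nonneg) auto
    \<comment> \<open>An upper bound for the ratio on the vertical pairs: the numerator behaves like
      (ln s) / 2, the denominator like ln s.\<close>
    let ?g = "\<lambda>s. ln (1 + sqrt (C * s)) / ln (1 + (s - 1 / s))"
    have "(?g \<longlongrightarrow> 1 / 2) at_top" using C by real_asymp
    moreover have "\<forall>\<^sub>F s in at_top. b \<le> ?g s"
      using eventually_gt_at_top[of 1]
    proof eventually_elim
      case (elim s)
      define x where "x = ((1 / s) *\<^sub>R axis (Max UNIV) 1 :: real^'n::{finite,linorder})"
      define y where "y = (s *\<^sub>R axis (Max UNIV) 1 :: real^'n::{finite,linorder})"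
      note h = vert[OF _ elim, folded x_def y_def C_def, simplified]
      have s: "s - 1 / s > 0" using elim by (simp add: field_simps less_1_mult)
      have "b \<le> ?B x y / ?H x y" using h(1-3) by (intro b) blast
      also have "\<dots> \<le> ?g s"
        unfolding cassinian_tilde_eq
        using h s SB[OF h(1,2)] C elim by (intro frac_le) auto
      finally show ?case .
    qed
    ultimately show "b \<le> 1 / 2" by (rule tendsto_lowerbound) simp
  qed (use ratio in blast)
  show ?thesis using bounds Sup Inf by blast
qed

end
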